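(* Let $K\ge 1$ and consider the canonical data shuffling problem with a master node, $K$ worker nodes, $N=K$ files, and a cache of size $S$ files at each worker node. For every integer $S\in[N]$, the communication load $$\rho(S)=\frac{\binom{K-1}{S}}{\binom{K-1}{S-1}}$$ is achievable for every file transition graph; that is, the constant family $\rho_d=\rho(S)$ ($d$ ranging over all permutations of $[K]$) is achievable with cache size $S$, so that the communication load satisfies $R(N=K,K,S)\le \binom{K-1}{S}/\binom{K-1}{S-1}$ whatever the next assignment $d$ is. For non-integer $S$ with $1\le S\le N$, the value at $S$ of the lower convex envelope of the $N$ corner points $(s,\rho(s))$, $s\in[N]$, is achievable in the same sense.
   Context: Notation: $[K]=\{1,\dots,K\}$; $\binom{n}{k}=0$ when $n<k$. Canonical data shuffling problem ($N=K$). There are $K$ files $F^1,\dots,F^K$, each a string of $B$ bits ($B$ a positive integer; the files are independent and uniformly distributed); the size of a file is normalized to $1$, i.e. all sizes are measured in units of $B$ bits. There are $K$ worker nodes $W_1,\dots,W_K$ and a master node that knows all files. At iteration $t$, worker $W_i$ processes file $F^i$ and stores it completely. Each worker has a cache of size $S$ files, where $1\le S\le K$ is real. An uncoded placement (with cache size $S$ and file length $B$) specifies, for every ordered pair $i\ne j$ in $[K]$, a set $\widetilde F^i_j$ of bits (bit positions) of $F^i$ stored in the excess storage of $W_j$, such that $\sum_{i\neq j}|\widetilde F^i_j|\le (S-1)B$ for every $j$. The cache content of $W_j$ is $\mathcal Z_j=F^j\cup\bigcup_{i\ne j}\widetilde F^i_j$. The placement is chosen without knowledge of the next assignment. The next assignment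 is a permutation $d$ of $[K]$: at iteration $t+1$ worker $W_i$ must process $F^{d(i)}$. A delivery for $d$ of load $L/B$ is a function $\mathcal X$ of all files with values in $\{0,1\}^L$ (broadcast by the master to all workers without error) such that for every $i\in[K]$ the file $F^{d(i)}$ is a function of $(\mathcal X,\mathcal Z_i)$. The file transition graph of $d$ is the directed graph on the workers with one edge per file, the edge of file $F^j$ going from the worker processing $F^j$ at iteration $t$ to the worker assigned $F^j$ at iteration $t+1$ (loops allowed); any such graph arises from some permutation $d$. A family of loads $(\rho_d)_d$, indexed by all permutations $d$ of $[K]$, is achievable with cache size $S$ if for every $\varepsilon>0$ there exist $B$ and one single uncoded placement (independent of $d$) such that for every $d$ there is a delivery for $d$ of load at most $\rho_d+\varepsilon$. *)

theory Defs
  imports "HOL-Analysis.Analysis" "HOL-Combinatorics.Permutations"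
begin

text \<open>All possible values of the K files, each a string of B bits.  The files are independent
  and uniform, so every element occurs with positive probability, and ``is a function of''
  means that the decoding identity holds for every element.\<close>

definition files :: "nat \<Rightarrow> nat \<Rightarrow> (nat \<Rightarrow> bool list) set" where
  "files K B = ({1..K} \<rightarrow>\<^sub>E {xs. length xs = B})"

text \<open>The set \<open>E i j\<close> consists of the bit positions of file i stored in the excess storage
  of worker j; its value for \<open>i = j\<close> or for indices outside \<open>{1..K}\<close> is irrelevant.\<close>

definition uncoded_placement :: "nat \<Rightarrow> real \<Rightarrow> nat \<Rightarrow> (nat \<Rightarrow> nat \<Rightarrow> nat set) \<Rightarrow> bool" where
  "uncoded_placement K S B E \<longleftrightarrow>
     (\<forall>j\<in>{1..K}. \<forall>i\<in>{1..K} - {j}. E i j \<subseteq> {..<B}) \<and>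
     (\<forall>j\<in>{1..K}. real (\<Sum>i\<in>{1..K} - {j}. card (E i j)) \<le> (S - 1) * real B)"

definition cached_bits :: "nat \<Rightarrow> nat \<Rightarrow> (nat \<Rightarrow> nat \<Rightarrow> nat set) \<Rightarrow> nat \<Rightarrow> (nat \<times> nat) set" where
  "cached_bits K B E j = ({j} \<times> {..<B}) \<union> (\<Union>i\<in>{1..K} - {j}. {i} \<times> E i j)"

definition cache_content ::
    "nat \<Rightarrow> nat \<Rightarrow> (nat \<Rightarrow> nat \<Rightarrow> nat set) \<Rightarrow> nat \<Rightarrow> (nat \<Rightarrow> bool list) \<Rightarrow> (nat \<times> nat \<rightharpoonup> bool)" where
  "cache_content K B E j F = (\<lambda>(i, b). Some (F i ! b)) |` cached_bits K B E j"

text \<open>The permutation d is the next assignment: worker i has to process file \<open>d i\<close>.  The load of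
  the delivery X, in units of files, is \<open>L / B\<close>.\<close>

definition is_delivery ::
    "nat \<Rightarrow> nat \<Rightarrow> (nat \<Rightarrow> nat \<Rightarrow> nat set) \<Rightarrow> (nat \<Rightarrow> nat) \<Rightarrow> nat \<Rightarrow>
     ((nat \<Rightarrow> bool list) \<Rightarrow> bool list) \<Rightarrow> bool" where
  "is_delivery K B E d L X \<longleftrightarrow>
     X \<in> files K B \<rightarrow> {x. length x = L} \<and>
     (\<forall>i\<in>{1..K}. \<exists>dec. \<forall>F\<in>files K B. F (d i) = dec (X F) (cache_content K B E i F))"

definition achievable :: "nat \<Rightarrow> real \<Rightarrow> ((nat \<Rightarrow> nat) \<Rightarrow> real) \<Rightarrow> bool" where
  "achievable K S \<rho> \<longleftrightarrow>
     (\<forall>\<epsilon>>0. \<exists>B>0. \<exists>E. uncoded_placement K S B E \<and>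
        (\<forall>d. d permutes {1..K} \<longrightarrow>
           (\<exists>L X. is_delivery K B E d L X \<and> real L / real B \<le> \<rho> d + \<epsilon>)))"

text \<open>The optimal load R(N = K, K, S), guaranteed simultaneously for all next assignments.\<close>

definition optimal_load :: "nat \<Rightarrow> real \<Rightarrow> real" where
  "optimal_load K S = Inf {r. achievable K S (\<lambda>d. r)}"

definition corner_load :: "nat \<Rightarrow> nat \<Rightarrow> real" where
  "corner_load K s = real ((K - 1) choose s) / real ((K - 1) choose (s - 1))"

definition lower_convex_envelope :: "(real \<times> real) set \<Rightarrow> real \<Rightarrow> real" where
  "lower_convex_envelope P x = Inf {y. (x, y) \<in> convex hull P}"

end

theory Submission
  imports Defs "HOL-Library.Z2"
begin

text \<open>
  For integral \<open>s\<close>, split file \<open>i\<close> into subfiles indexed by the sets \<open>\<Gamma> \<subseteq> [K] - {i}\<close> with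
  \<open>|\<Gamma>| = s - 1\<close>, and let worker \<open>j\<close> store those with \<open>j \<in> \<Gamma>\<close>.  Over the two-element field, the
  subfiles extend uniquely to a function \<open>F\<^sup>i\<close> on all \<open>(s - 1)\<close>-sets that is a cycle of the full
  simplex on \<open>[K]\<close>, and then worker \<open>j\<close> knows \<open>F\<^sup>i\<close> on all sets containing \<open>j\<close>.  For
  \<open>|\<Delta>| = s\<close> put \<open>X \<Delta> = (\<Sum>i\<in>\<Delta>. F\<^sup>i (\<Delta> - {i}) + F\<^bsup>d i\<^esup> (\<Delta> - {i}))\<close>.  Worker \<open>i\<close> reads
  \<open>F\<^bsup>d i\<^esup> \<Gamma>\<close> for \<open>i \<notin> \<Gamma>\<close> off \<open>X (insert i \<Gamma>)\<close>, every other summand being cached.  Since \<open>d\<close> is a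
  permutation, the files and their reassigned copies sum to zero, which makes \<open>X\<close> a cycle too; hence
  its values on the \<open>(K-1 choose s)\<close> sets avoiding \<open>K\<close> determine it, and only these are broadcast.

  Points of the convex hull are reached by memory sharing: the scheme for \<open>s\<close> is used on a fraction
  \<open>\<lambda>\<^sub>s\<close> of the bits, rounded down for \<open>s \<ge> 2\<close>, with the remaining bits given to \<open>s = 1\<close>, which needs
  no excess storage, so that the storage constraint holds exactly and only the load suffers.
\<close>

section \<open>Cycles of the full simplex over the two-element field\<close>

declare add_bit_eq_xor [simp del] \<comment> \<open>it would take sums out of reach of the ring lemmas\<close>

lemma bit_self_add: "(x::bit) + x = 0" by (cases x) auto

text \<open>Every unordered pair is counted twice and cancels.\<close>

lemma sum_symmetric_off_diagonal_bit:
  fixes g :: "'a \<Rightarrow> 'a \<Rightarrow> bit"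
  assumes "finite A" "\<And>x y. g x y = g y x"
  shows "(\<Sum>x\<in>A. \<Sum>y\<in>A - {x}. g x y) = 0"
  using assms(1)
proof (induction A)
  case (insert a A)
  have "(\<Sum>y\<in>insert a A - {x}. g x y) = g x a + (\<Sum>y\<in>A - {x}. g x y)" if "x \<in> A" for x
  proof -
    have "insert a A - {x} = insert a (A - {x})" using insert that by auto
    then show ?thesis using insert by simp
  qed
  then have "(\<Sum>x\<in>A. \<Sum>y\<in>insert a A - {x}. g x y) = (\<Sum>x\<in>A. g a x)"
    using insert assms(2) by (simp add: sum.distrib)
  moreover have "insert a A - {a} = A" using insert by auto
  ultimately show ?case using insert by (simp add: bit_self_add)
qed simp

text \<open>A cycle is a function \<open>g\<close> with zero boundary: for every
  \<open>T \<subseteq> V\<close> the sum of \<open>g (insert l T)\<close> over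
  \<open>l \<in> V - T\<close> is 0. At a set containing \<open>i\<close> the value is the one
  forced by this condition at \<open>\<Gamma> - {i}\<close>; so this is \<open>f\<close> plus the
  cone with apex \<open>i\<close> over its boundary.\<close>

definition cycle_ext :: "'a set \<Rightarrow> 'a \<Rightarrow> ('a set \<Rightarrow> bit) \<Rightarrow> 'a set \<Rightarrow> bit" where
  "cycle_ext V i f \<Gamma> =
     (if i \<in> \<Gamma> then \<Sum>l\<in>V - \<Gamma>. f (insert l (\<Gamma> - {i})) else f \<Gamma>)"

text \<open>For \<open>i \<notin> T\<close> the term \<open>l = i\<close> equals the sum of the
  others by construction; for \<open>i \<in> T\<close> this is the vanishing of the boundary of a
  boundary.\<close>

lemma cycle_ext_cycle:
  assumes "finite V" "i \<in> V" "T \<subseteq> V"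
  shows "(\<Sum>l\<in>V - T. cycle_ext V i f (insert l T)) = 0"
proof (cases "i \<in> T")
  case True
  have "(\<Sum>l\<in>V - T. cycle_ext V i f (insert l T)) =
      (\<Sum>l\<in>V - T. \<Sum>l'\<in>V - T - {l}. f (insert l' (insert l (T - {i}))))"
  proof (rule sum.cong)
    fix l assume l: "l \<in> V - T"
    then have "V - insert l T = V - T - {l}" "insert l T - {i} = insert l (T - {i})" 
      using True by auto
    then show "cycle_ext V i f (insert l T) =
        (\<Sum>l'\<in>V - T - {l}. f (insert l' (insert l (T - {i}))))"
      using True by (simp add: cycle_ext_def)
  qed simp
  also have "\<dots> = 0"
    using assms by (intro sum_symmetric_off_diagonal_bit) (auto simp: insert_commute)
  finally show ?thesis .
next
  case False
  have "V - insert i T = V - T - {i}" "insert i T - {i} = T" using False by auto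
  then have "cycle_ext V i f (insert i T) = (\<Sum>l\<in>V - T - {i}. f (insert l T))"
    by (simp add: cycle_ext_def)
  moreover have "(\<Sum>l\<in>V - T - {i}. cycle_ext V i f (insert l T)) = (\<Sum>l\<in>V - T - {i}. f (insert l T))"
    using False by (intro sum.cong) (auto simp: cycle_ext_def)
  ultimately show ?thesis
    using False assms by (simp add: sum.remove[of "V - T" i] bit_self_add)
qed

definition messages :: "('a \<Rightarrow> 'a set \<Rightarrow> bit) \<Rightarrow> 'a set \<Rightarrow> bit" where
  "messages a \<Delta> = (\<Sum>i\<in>\<Delta>. a i (\<Delta> - {i}))"

lemma messages_insert:
  assumes "finite \<Gamma>" "i \<notin> \<Gamma>"
  shows "messages a (insert i \<Gamma>) = a i \<Gamma> + (\<Sum>j\<in>\<Gamma>. a j (insert i (\<Gamma> - {j})))"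
proof -
  have "insert i \<Gamma> - {j} = insert i (\<Gamma> - {j})" if "j \<in> \<Gamma>" for j using that assms by auto
  then show ?thesis using assms by (simp add: messages_def)
qed

text \<open>The cone with apex \<open>i\<close> over the part of the cycle \<open>a i\<close> that
  avoids \<open>i\<close> has boundary \<open>a i\<close>. As \<open>messages a\<close> is the sum
  of these cones, its boundary at \<open>T\<close> is the sum in \<open>zero\<close>.\<close>

lemma messages_cycle:
  assumes V: "finite V" "T \<subseteq> V"
    and cyc: "\<And>i T. i \<in> V \<Longrightarrow> T \<subseteq> V \<Longrightarrow> (\<Sum>l\<in>V - T. a i (insert l T)) = 0"
    and zero: "(\<Sum>i\<in>V. a i T) = 0"
  shows "(\<Sum>l\<in>V - T. messages a (insert l T)) = 0"
proof -
  have fin: "finite T" using V finite_subset by blast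
  \<comment> \<open>The cycle condition at \<open>T - {i}\<close>, solved for its term
    \<open>l = i\<close>.\<close>
  have *: "(\<Sum>l\<in>V - T. a i (insert l (T - {i}))) = a i T" if "i \<in> T" for i
  proof -
    have "V - (T - {i}) = insert i (V - T)" "insert i (T - {i}) = T" using that V by auto
    then have "a i T + (\<Sum>l\<in>V - T. a i (insert l (T - {i}))) = 0"
      using cyc[of i "T - {i}"] that V by (auto simp: subset_iff)
    then show ?thesis by (metis add.commute add.left_commute add.right_neutral bit_self_add)
  qed
  have "(\<Sum>l\<in>V - T. messages a (insert l T)) =
      (\<Sum>l\<in>V - T. a l T) + (\<Sum>l\<in>V - T. \<Sum>i\<in>T. a i (insert l (T - {i})))"
    using fin by (simp add: messages_insert sum.distrib)
  also have "(\<Sum>l\<in>V - T. \<Sum>i\<in>T. a i (insert l (T - {i}))) = (\<Sum>i\<in>T. a i T)"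
    by (subst sum.swap) (simp add: *)
  also have "(\<Sum>l\<in>V - T. a l T) + (\<Sum>i\<in>T. a i T) = 0"
    using zero V by (metis sum.subset_diff)
  finally show ?thesis .
qed

lemma messages_determined:
  assumes V: "finite V" "\<Delta> \<subseteq> V" "r \<in> \<Delta>"
    and cyc: "\<And>i T. i \<in> V \<Longrightarrow> T \<subseteq> V \<Longrightarrow> (\<Sum>l\<in>V - T. a i (insert l T)) = 0"
    and zero: "(\<Sum>i\<in>V. a i (\<Delta> - {r})) = 0"
  shows "messages a \<Delta> = (\<Sum>l\<in>V - \<Delta>. messages a (insert l (\<Delta> - {r})))"
proof -
  have "V - (\<Delta> - {r}) = insert r (V - \<Delta>)" "insert r (\<Delta> - {r}) = \<Delta>" using V by auto
  then have "messages a \<Delta> + (\<Sum>l\<in>V - \<Delta>. messages a (insert l (\<Delta> - {r}))) = 0"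
    using messages_cycle[of V "\<Delta> - {r}" a] assms by (auto simp: subset_iff)
  then show ?thesis by (metis add.commute add.left_commute add.right_neutral bit_self_add)
qed

section \<open>Counting sets and existence of decoders\<close>

definition subsets :: "'a set \<Rightarrow> nat \<Rightarrow> 'a set set" where
  "subsets V r = {\<Gamma>. \<Gamma> \<subseteq> V \<and> card \<Gamma> = r}"

text \<open>Used for the cached share: a fraction \<open>r / card W\<close> of the
  \<open>r\<close>-sets contains \<open>j\<close>, by the absorption identity for binomials.\<close>

lemma card_subsets_containing:
  assumes "finite W" "j \<in> W"
  shows "card {\<Gamma> \<in> subsets W r. j \<in> \<Gamma>} * card W = r * (card W choose r)"
proof (cases r)
  case 0
  have "{\<Gamma> \<in> subsets W 0. j \<in> \<Gamma>} = {}" using assms by (auto simp: subsets_def) (metis card_0_eq empty_iff finite_subset)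
  then show ?thesis by (simp only: 0 card.empty mult_0)
next
  case (Suc q)
  have "{\<Gamma> \<in> subsets W r. j \<in> \<Gamma>} = insert j ` subsets (W - {j}) q"
  proof (intro equalityI subsetI)
    fix \<Gamma> assume \<Gamma>: "\<Gamma> \<in> {\<Gamma> \<in> subsets W r. j \<in> \<Gamma>}"
    then have "finite \<Gamma>" using assms finite_subset by (auto simp: subsets_def)
    then have "\<Gamma> - {j} \<in> subsets (W - {j}) q" using \<Gamma> Suc by (auto simp: subsets_def)
    moreover have "\<Gamma> = insert j (\<Gamma> - {j})" using \<Gamma> by auto
    ultimately show "\<Gamma> \<in> insert j ` subsets (W - {j}) q" by blast
  next
    fix \<Gamma> assume "\<Gamma> \<in> insert j ` subsets (W - {j}) q"
    then obtain \<Gamma>' where \<Gamma>': "\<Gamma>' \<subseteq> W - {j}" "card \<Gamma>' = q" "\<Gamma> = insert j \<Gamma>'" 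
      by (auto simp: subsets_def)
    then have "finite \<Gamma>'" "j \<notin> \<Gamma>'" using assms finite_subset[of \<Gamma>'] by auto
    then show "\<Gamma> \<in> {\<Gamma> \<in> subsets W r. j \<in> \<Gamma>}" using \<Gamma>' assms Suc by (auto simp: subsets_def)
  qed
  moreover have "inj_on (insert j) (subsets (W - {j}) q)"
    by (auto simp: inj_on_def subsets_def)
  ultimately have "card {\<Gamma> \<in> subsets W r. j \<in> \<Gamma>} = (card W - 1) choose q"
    using assms by (simp add: card_image subsets_def n_subsets)
  moreover obtain w where "card W = Suc w" using assms by (cases "card W") auto
  ultimately show ?thesis using Suc Suc_times_binomial[of q w] by (simp add: mult.commute)
qed

text \<open>A function constant on the common fibres of \<open>g\<close> and \<open>h\<close>
  factors through them. Decoding thus reduces to comparing two file tuples that look alike to a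
  worker.\<close>

lemma decoder_exists:
  assumes "\<And>x y. x \<in> A \<Longrightarrow> y \<in> A \<Longrightarrow> g x = g y \<Longrightarrow> h x = h y \<Longrightarrow> f x = f y"
  shows "\<exists>dec. \<forall>x\<in>A. f x = dec (g x) (h x)"
proof -
  have "f x = f (SOME y. y \<in> A \<and> g y = g x \<and> h y = h x)" if "x \<in> A" for x
    using someI[of "\<lambda>y. y \<in> A \<and> g y = g x \<and> h y = h x" x] that assms by metis
  then show ?thesis
    by (intro exI[of _ "\<lambda>u v. f (SOME y. y \<in> A \<and> g y = u \<and> h y = v)"]) blast
qed

lemma cache_content_eqD:
  assumes "cache_content K B E j F = cache_content K B E j F'" "(i, b) \<in> cached_bits K B E j"
  shows "F i ! b = F' i ! b"
  using fun_cong[OF assms(1), of "(i, b)"] assms(2) by (simp add: cache_content_def)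

section \<open>The coded scheme for given layer counts\<close>

locale shuffling_scheme =
  fixes K :: nat and m :: "nat \<Rightarrow> nat"
  assumes K: "K \<ge> 1"
begin

text \<open>The scheme for \<open>s\<close> is used on \<open>m s\<close> separate layers, numbered by \<open>c\<close>; a label \<open>(s, c, \<Gamma>)\<close>
  stands for one bit.\<close>

definition labels :: "nat \<Rightarrow> (nat \<times> nat \<times> nat set) set" where
  "labels i = (SIGMA s:{1..K}. {..<m s} \<times> subsets ({1..K} - {i}) (s - 1))"

definition message_labels :: "(nat \<times> nat \<times> nat set) set" where
  "message_labels = (SIGMA s:{1..K}. {..<m s} \<times> subsets ({1..K} - {K}) s)"

definition file_size :: nat where
  "file_size = (\<Sum>s\<in>{1..K}. m s * ((K - 1) choose (s - 1)))"

definition message_size :: nat where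
  "message_size = (\<Sum>s\<in>{1..K}. m s * ((K - 1) choose s))"

text \<open>Any numbering of the labels by bit positions serves; \<open>bij_pos\<close> shows that
  one exists for \<open>i \<in> {1..K}\<close>.\<close>

definition pos :: "nat \<Rightarrow> nat \<times> nat \<times> nat set \<Rightarrow> nat" where
  "pos i = (SOME \<phi>. bij_betw \<phi> (labels i) {..<file_size})"

definition placement :: "nat \<Rightarrow> nat \<Rightarrow> nat set" where
  "placement i j = pos i ` {(s, c, \<Gamma>) \<in> labels i. j \<in> \<Gamma>}"

text \<open>At sets of size \<open>s - 1\<close> within \<open>{1..K}\<close>, the extension
  evaluates \<open>pos i\<close> only at sets of that size avoiding \<open>i\<close>, hence inside
  \<open>labels i\<close> for valid \<open>s\<close> and \<open>c\<close>.\<close>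

definition subfile :: "(nat \<Rightarrow> bool list) \<Rightarrow> nat \<Rightarrow> nat \<Rightarrow> nat \<Rightarrow> nat set \<Rightarrow> bit" where
  "subfile F s c i = cycle_ext {1..K} i (\<lambda>\<Gamma>. of_bool (F i ! pos i (s, c, \<Gamma>)))"

definition message ::
    "(nat \<Rightarrow> nat) \<Rightarrow> (nat \<Rightarrow> bool list) \<Rightarrow> nat \<Rightarrow> nat \<Rightarrow> nat set \<Rightarrow> bit" where
  "message d F s c = messages (\<lambda>i \<Gamma>. subfile F s c i \<Gamma> + subfile F s c (d i) \<Gamma>)"

definition message_order :: "(nat \<times> nat \<times> nat set) list" where
  "message_order = (SOME xs. set xs = message_labels \<and> distinct xs)"

definition codeword :: "(nat \<Rightarrow> nat) \<Rightarrow> (nat \<Rightarrow> bool list) \<Rightarrow> bool list" where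
  "codeword d F = map (\<lambda>(s, c, \<Delta>). message d F s c \<Delta> = 1) message_order"

section \<open>Sizes and storage\<close>

lemma finite_subsets [simp]: "finite V \<Longrightarrow> finite (subsets V r)"
  by (simp add: subsets_def)

lemma card_subsets: "i \<in> {1..K} \<Longrightarrow> card (subsets ({1..K} - {i}) r) = (K - 1) choose r"
  by (simp add: subsets_def n_subsets)

lemma finite_labels: "finite (labels i)" "finite message_labels"
  by (simp_all add: labels_def message_labels_def)

lemma bij_pos: "i \<in> {1..K} \<Longrightarrow> bij_betw (pos i) (labels i) {..<file_size}"
proof -
  assume "i \<in> {1..K}"
  then have "card (labels i) = file_size"
    by (simp add: labels_def file_size_def card_subsets[simplified] card_cartesian_product)
  then have "\<exists>\<phi>. bij_betw \<phi> (labels i) {..<file_size}"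
    using finite_labels by (intro finite_same_card_bij) auto
  then show ?thesis unfolding pos_def by (rule someI_ex)
qed

lemma message_order: "set message_order = message_labels" "length message_order = message_size"
proof -
  have *: "set message_order = message_labels \<and> distinct message_order"
    unfolding message_order_def by (rule someI_ex) (rule finite_distinct_list[OF finite_labels(2)])
  then show "set message_order = message_labels" ..
  have "card message_labels = message_size"
    using K
    by (simp add: message_labels_def message_size_def card_subsets[simplified] card_cartesian_product)
  then show "length message_order = message_size" using * distinct_card by metis
qed

lemma placement_subset: "i \<in> {1..K} \<Longrightarrow> placement i j \<subseteq> {..<file_size}"
  using bij_pos[of i] by (auto simp: placement_def bij_betw_def)

text \<open>Worker \<open>j\<close> stores the share \<open>(s - 1) / (K - 1)\<close> of the
  scheme-\<open>s\<close> bits of each other file; the factor \<open>K - 1\<close> is kept on the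
  left to avoid division.\<close>

lemma card_placement:
  assumes "i \<in> {1..K}" "j \<in> {1..K}" "i \<noteq> j"
  shows "card (placement i j) * (K - 1)
    = (\<Sum>s\<in>{1..K}. (s - 1) * (m s * ((K - 1) choose (s - 1))))"
proof -
  let ?W = "{1..K} - {i}"
  have "{(s, c, \<Gamma>) \<in> labels i. j \<in> \<Gamma>}
      = (SIGMA s:{1..K}. {..<m s} \<times> {\<Gamma> \<in> subsets ?W (s - 1). j \<in> \<Gamma>})"
    by (auto simp: labels_def)
  moreover have "inj_on (pos i) {(s, c, \<Gamma>) \<in> labels i. j \<in> \<Gamma>}"
    using bij_pos[OF assms(1)] by (auto simp: bij_betw_def intro: inj_on_subset)
  ultimately have "card (placement i j)
      = (\<Sum>s\<in>{1..K}. m s * card {\<Gamma> \<in> subsets ?W (s - 1). j \<in> \<Gamma>})"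
    by (simp add: placement_def card_image card_cartesian_product)
  moreover have "card {\<Gamma> \<in> subsets ?W r. j \<in> \<Gamma>} * (K - 1) = r * ((K - 1) choose r)" for r
    using card_subsets_containing[of ?W j r] assms by simp
  ultimately show ?thesis
    by (simp add: sum_distrib_right mult.assoc mult.left_commute)
qed

lemma sum_card_placement:
  assumes "j \<in> {1..K}"
  shows "(\<Sum>i\<in>{1..K} - {j}. card (placement i j))
    \<le> (\<Sum>s\<in>{1..K}. (s - 1) * (m s * ((K - 1) choose (s - 1))))"
    (is "?l \<le> ?M")
\<comment> \<open>The factor \<open>K - 1\<close> is cancelled against the number of other files;
  for \<open>K = 1\<close> there are none.\<close>
proof (cases "K = 1")
  case False
  have "?l * (K - 1) = (\<Sum>i\<in>{1..K} - {j}. ?M)"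
    unfolding sum_distrib_right using assms by (intro sum.cong refl card_placement) auto
  also have "\<dots> = ?M * (K - 1)" using assms by simp
  finally show ?thesis using K False by simp
qed (use assms in simp)

section \<open>Recovering messages and decoding\<close>

lemma message_determined:
  assumes "d permutes {1..K}" "\<Delta> \<subseteq> {1..K}" "K \<in> \<Delta>"
  shows "message d F s c \<Delta> = (\<Sum>l\<in>{1..K} - \<Delta>. message d F s c (insert l (\<Delta> - {K})))"
  unfolding message_def
proof (rule messages_determined)
  show "(\<Sum>l\<in>{1..K} - T. subfile F s c i (insert l T) + subfile F s c (d i) (insert l T)) = 0"
    if "i \<in> {1..K}" "T \<subseteq> {1..K}" for i T
    unfolding sum.distrib subfile_def
    using that permutes_in_image[OF assms(1), of i] by (simp add: cycle_ext_cycle)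
  show "(\<Sum>i\<in>{1..K}. subfile F s c i (\<Delta> - {K}) + subfile F s c (d i) (\<Delta> - {K})) = 0"
    unfolding sum.distrib 
    using sum.permute[OF assms(1), of "\<lambda>i. subfile F s c i (\<Delta> - {K})"]
    by (simp add: comp_def bit_self_add)
qed (use assms in auto)

text \<open>Sets avoiding \<open>K\<close> are broadcast; for the others,
  \<open>message_determined\<close> involves only sets avoiding \<open>K\<close>.\<close>

lemma codeword_eqD:
  assumes d: "d permutes {1..K}" and eq: "codeword d F = codeword d F'"
    and s: "s \<in> {1..K}" "c < m s" and \<Delta>: "\<Delta> \<in> subsets {1..K} s"
  shows "message d F s c \<Delta> = message d F' s c \<Delta>"
proof -
  have *: "message d F s c \<Delta> = message d F' s c \<Delta>" if "\<Delta> \<in> subsets ({1..K} - {K}) s" for \<Delta>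
  proof -
    have "(s, c, \<Delta>) \<in> set message_order" using message_order s that by (auto simp: message_labels_def)
    then have "(message d F s c \<Delta> = 1) = (message d F' s c \<Delta> = 1)"
      using eq by (fastforce simp: codeword_def)
    then show ?thesis by (metis bit_not_one_iff)
  qed
  show ?thesis
  proof (cases "K \<in> \<Delta>")
    case True
    have "insert l (\<Delta> - {K}) \<in> subsets ({1..K} - {K}) s" if "l \<in> {1..K} - \<Delta>" for l
    proof -
      have "finite \<Delta>" using \<Delta> finite_subset by (auto simp: subsets_def)
      then show ?thesis using that \<Delta> True s by (auto simp: subsets_def)
    qed
    then show ?thesis
      using \<Delta> True by (simp add: message_determined[OF d] subsets_def *)
  next
    case False
    then show ?thesis using \<Delta> * by (auto simp: subsets_def)
  qed
qed

text \<open>If \<open>i \<in> \<Gamma>\<close> and \<open>i \<noteq> j\<close>, the value is a sum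
  over sets in which some \<open>l\<close> replaces \<open>i\<close>; these still contain
  \<open>j\<close>, so worker \<open>j\<close> stores their bits.\<close>

lemma subfile_cached:
  assumes eq: "cache_content K file_size placement j F = cache_content K file_size placement j F'"
    and F: "F \<in> files K file_size" "F' \<in> files K file_size"
    and i: "i \<in> {1..K}" and j: "j \<in> {1..K}" and \<Gamma>: "\<Gamma> \<in> subsets {1..K} (s - 1)"
    and s: "s \<in> {1..K}" "c < m s" and cached: "i = j \<or> j \<in> \<Gamma>"
  shows "subfile F s c i \<Gamma> = subfile F' s c i \<Gamma>"
proof (cases "i = j")
  case True
  have "F j ! b = F' j ! b" if "b < file_size" for b
    using that by (intro cache_content_eqD[OF eq]) (auto simp: cached_bits_def)
  then have "F j = F' j"
    using F j by (intro nth_equalityI) (auto simp: files_def PiE_iff)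
  then show ?thesis using True by (simp add: subfile_def)
next
  case False
  have *: "F i ! pos i (s, c, \<Gamma>) = F' i ! pos i (s, c, \<Gamma>)"
    if "\<Gamma> \<in> subsets ({1..K} - {i}) (s - 1)" "j \<in> \<Gamma>" for \<Gamma>
  proof (rule cache_content_eqD[OF eq])
    have "pos i (s, c, \<Gamma>) \<in> placement i j"
      unfolding placement_def using that s by (intro imageI) (auto simp: labels_def)
    then show "(i, pos i (s, c, \<Gamma>)) \<in> cached_bits K file_size placement j"
      using False i by (auto simp: cached_bits_def)
  qed
  show ?thesis
  proof (cases "i \<in> \<Gamma>")
    case True
    have "insert l (\<Gamma> - {i}) \<in> subsets ({1..K} - {i}) (s - 1)" "j \<in> insert l (\<Gamma> - {i})"
      if "l \<in> {1..K} - \<Gamma>" for l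
    proof -
      have "finite \<Gamma>" using \<Gamma> finite_subset by (auto simp: subsets_def)
      then have "card (insert l (\<Gamma> - {i})) = card \<Gamma>"
        using True that by (metis DiffD1 DiffD2 card_Suc_Diff1 card_insert_disjoint finite_Diff)
      then show "insert l (\<Gamma> - {i}) \<in> subsets ({1..K} - {i}) (s - 1)"
        using that \<Gamma> True by (auto simp: subsets_def)
      show "j \<in> insert l (\<Gamma> - {i})" using cached False by auto
    qed
    then show ?thesis
      unfolding subfile_def cycle_ext_def using True by (simp add: *)
  next
    case nin: False
    then have "\<Gamma> \<in> subsets ({1..K} - {i}) (s - 1)" using \<Gamma> by (auto simp: subsets_def)
    then show ?thesis
      unfolding subfile_def cycle_ext_def using nin cached False by (simp add: *)
  qed
qed

lemma subfile_decoded: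
  assumes d: "d permutes {1..K}" and eqX: "codeword d F = codeword d F'"
    and eqZ: "cache_content K file_size placement i F = cache_content K file_size placement i F'"
    and F: "F \<in> files K file_size" "F' \<in> files K file_size"
    and i: "i \<in> {1..K}" and \<Gamma>: "\<Gamma> \<in> subsets {1..K} (s - 1)"
    and s: "s \<in> {1..K}" "c < m s"
  shows "subfile F s c (d i) \<Gamma> = subfile F' s c (d i) \<Gamma>"
proof (cases "i \<in> \<Gamma>")
  case True
  then show ?thesis
    using subfile_cached[OF eqZ F _ i \<Gamma> s] permutes_in_image[OF d] i by blast
next
  case False
  have fin: "finite \<Gamma>" using \<Gamma> finite_subset by (auto simp: subsets_def)
  then have "insert i \<Gamma> \<in> subsets {1..K} s" using \<Gamma> i False s by (auto simp: subsets_def)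
  then have "message d F s c (insert i \<Gamma>) = message d F' s c (insert i \<Gamma>)"
    by (rule codeword_eqD[OF d eqX s])
  moreover have "subfile F s c i \<Gamma> = subfile F' s c i \<Gamma>"
    using subfile_cached[OF eqZ F i i \<Gamma> s] by simp
  \<comment> \<open>Stated for arbitrary \<open>k\<close>, as it is applied to both \<open>j\<close>
    and \<open>d j\<close>.\<close>
  moreover have "subfile F s c k (insert i (\<Gamma> - {j})) = subfile F' s c k (insert i (\<Gamma> - {j}))"
    if "j \<in> \<Gamma>" "k \<in> {1..K}" for j k
  proof -
    have "card (insert i (\<Gamma> - {j})) = card \<Gamma>"
      using False that fin by (metis DiffD1 card_Suc_Diff1 card_insert_disjoint finite_Diff)
    then have "insert i (\<Gamma> - {j}) \<in> subsets {1..K} (s - 1)"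
      using \<Gamma> i by (auto simp: subsets_def)
    then show ?thesis using subfile_cached[OF eqZ F that(2) i _ s] by blast
  qed
  moreover have "j \<in> {1..K}" "d j \<in> {1..K}" if "j \<in> \<Gamma>" for j
    using that \<Gamma> permutes_in_image[OF d, of j] unfolding subsets_def by blast+
  ultimately show ?thesis
    using fin False by (simp add: message_def messages_insert)
qed

lemma is_delivery_codeword:
  assumes d: "d permutes {1..K}"
  shows "is_delivery K file_size placement d message_size (codeword d)"
  unfolding is_delivery_def
proof (intro conjI ballI decoder_exists)
  show "codeword d \<in> files K file_size \<rightarrow> {x. length x = message_size}"
    by (auto simp: codeword_def message_order)
next
  fix i F F'
  assume i: "i \<in> {1..K}" and F: "F \<in> files K file_size" "F' \<in> files K file_size"
    and eqX: "codeword d F = codeword d F'"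
    and eqZ: "cache_content K file_size placement i F = cache_content K file_size placement i F'"
  have di: "d i \<in> {1..K}" using permutes_in_image[OF d] i by blast
  show "F (d i) = F' (d i)"
  proof (rule nth_equalityI)
    show "length (F (d i)) = length (F' (d i))" using F di by (auto simp: files_def PiE_iff)
    fix b assume "b < length (F (d i))"
    then have "b < file_size" using F di by (auto simp: files_def PiE_iff)
    then have "b \<in> pos (d i) ` labels (d i)" using bij_pos[OF di] by (simp add: bij_betw_def)
    then obtain s c \<Gamma> where b: "b = pos (d i) (s, c, \<Gamma>)" "(s, c, \<Gamma>) \<in> labels (d i)"
      by auto
    then have "subfile F s c (d i) \<Gamma> = subfile F' s c (d i) \<Gamma>"
      by (intro subfile_decoded[OF d eqX eqZ F i]) (auto simp: labels_def subsets_def)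
    \<comment> \<open>On a set avoiding \<open>d i\<close> the extension is the raw bit of the
      file.\<close>
    moreover have "d i \<notin> \<Gamma>" using b by (auto simp: labels_def subsets_def)
    ultimately show "F (d i) ! b = F' (d i) ! b"
      using b by (simp add: subfile_def cycle_ext_def of_bool_def split: if_splits)
  qed
qed

end

section \<open>Memory sharing between integral cache sizes\<close>

lemma achievable_memory_sharing:
  fixes lam :: "nat \<Rightarrow> real"
  assumes K: "K \<ge> 1" and lam: "\<And>s. s \<in> {1..K} \<Longrightarrow> 0 \<le> lam s" "(\<Sum>s\<in>{1..K}. lam s) = 1"
  shows "achievable K (\<Sum>s\<in>{1..K}. lam s * real s)
    (\<lambda>d. \<Sum>s\<in>{1..K}. lam s * corner_load K s)"
    (is "achievable K ?S (\<lambda>d. ?y)")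
  unfolding achievable_def
proof (intro allI impI)
  fix \<epsilon> :: real assume \<epsilon>: "\<epsilon> > 0"
  \<comment> \<open>The number of bits of a file covered by one layer of the scheme for
    \<open>s\<close>.\<close>
  define C where "C s = (K - 1) choose (s - 1)" for s
  let ?\<rho> = "corner_load K"
  \<comment> \<open>Rounding loses at most \<open>C s\<close> bits for each
    \<open>s \<ge> 2\<close>; moving them to the scheme for 1 costs at most \<open>?D\<close>
    broadcast bits.\<close>
  let ?D = "?\<rho> 1 * (\<Sum>s\<in>{2..K}. real (C s))"
  have C: "C s > 0" if "s \<in> {1..K}" for s
    using that by (auto simp: C_def zero_less_binomial_iff)
  have C1: "C 1 = 1" by (simp add: C_def)
  have \<rho>: "?\<rho> s \<ge> 0" for s by (simp add: corner_load_def)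
  have C\<rho>: "real ((K - 1) choose s) = real (C s) * ?\<rho> s" if "s \<in> {1..K}" for s
    using C[OF that] by (simp add: corner_load_def C_def)
  have split: "(\<Sum>s\<in>{1..K}. g s) = g 1 + (\<Sum>s\<in>{2..K}. g s)" for g :: "nat \<Rightarrow> 'b::comm_monoid_add"
    using sum.atLeast_Suc_atMost[OF K, of g] by (simp add: numeral_2_eq_2)
  \<comment> \<open>\<open>n\<close> becomes the file length, large enough for \<open>?D\<close>
    bits to be a load of at most \<epsilon>.\<close>
  obtain n :: nat where n: "n > 0" "?D \<le> \<epsilon> * real n"
  proof
    show "nat \<lceil>?D / \<epsilon>\<rceil> + 1 > 0" by simp
    have "?D / \<epsilon> \<le> real (nat \<lceil>?D / \<epsilon>\<rceil> + 1)" by linarith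
    then show "?D \<le> \<epsilon> * real (nat \<lceil>?D / \<epsilon>\<rceil> + 1)" using \<epsilon> by (simp add: field_simps)
  qed
  define q where "q s = nat \<lfloor>lam s * real n / real (C s)\<rfloor>" for s
  have q: "real (q s) * real (C s) \<le> lam s * real n"
      "lam s * real n \<le> real (q s) * real (C s) + real (C s)" if "s \<in> {1..K}" for s
  proof -
    have "0 \<le> lam s * real n / real (C s)" using lam(1)[OF that] by simp
    then have "real (q s) \<le> lam s * real n / real (C s)"
      "lam s * real n / real (C s) \<le> real (q s) + 1"
      unfolding q_def by linarith+
    then show "real (q s) * real (C s) \<le> lam s * real n"
      "lam s * real n \<le> real (q s) * real (C s) + real (C s)"
      using C[OF that] by (simp_all add: field_simps)
  qed
  have lam_n: "real n = lam 1 * real n + (\<Sum>s\<in>{2..K}. lam s * real n)"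
    using lam(2) unfolding split sum_distrib_right[symmetric] distrib_right[symmetric] by simp
  have "(\<Sum>s\<in>{2..K}. real (q s) * real (C s)) \<le> (\<Sum>s\<in>{2..K}. lam s * real n)"
    by (intro sum_mono q) auto
  also have "\<dots> \<le> real n"
  proof -
    have "0 \<le> lam 1 * real n" using lam(1)[of 1] K by simp
    then show ?thesis using lam_n by linarith
  qed
  finally have "real (\<Sum>s\<in>{2..K}. q s * C s) \<le> real n" by simp
  then have le_n: "(\<Sum>s\<in>{2..K}. q s * C s) \<le> n" by linarith
  \<comment> \<open>A layer for \<open>s = 1\<close> is a single bit, so it fills the remainder
    exactly; by \<open>le_n\<close> the subtraction is not truncated.\<close>
  define m where "m s = (if s = 1 then n - (\<Sum>s\<in>{2..K}. q s * C s) else q s)" for s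
  have m: "m s = q s" if "s \<in> {2..K}" for s using that by (auto simp: m_def)
  interpret shuffling_scheme K m by unfold_locales (fact K)
  have size: "file_size = n"
    unfolding file_size_def C_def[symmetric] split C1 using le_n by (simp add: m) (simp add: m_def)
  \<comment> \<open>The remainder enters with the factor \<open>s - 1 = 0\<close>.\<close>
  have "(\<Sum>s\<in>{1..K}. (s - 1) * (m s * C s)) = (\<Sum>s\<in>{2..K}. (s - 1) * (q s * C s))"
    unfolding split by (simp add: m)
  then have "real (\<Sum>s\<in>{1..K}. (s - 1) * (m s * C s))
      = (\<Sum>s\<in>{2..K}. real (s - 1) * (real (q s) * real (C s)))" by simp
  also have "\<dots> \<le> (\<Sum>s\<in>{2..K}. real (s - 1) * (lam s * real n))"
    by (intro sum_mono mult_left_mono q) auto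
  also have "\<dots> = (\<Sum>s\<in>{1..K}. (real s - 1) * lam s) * real n"
    unfolding split by (simp add: of_nat_diff sum_distrib_right mult.assoc)
  also have "(\<Sum>s\<in>{1..K}. (real s - 1) * lam s) = ?S - 1"
    using lam(2) by (simp add: algebra_simps sum_subtractf)
  finally have "real (\<Sum>s\<in>{1..K}. (s - 1) * (m s * C s)) \<le> (?S - 1) * real n" .
  then have storage: "real (\<Sum>i\<in>{1..K} - {j}. card (placement i j)) \<le> (?S - 1) * real n"
    if "j \<in> {1..K}" for j
    using sum_card_placement[OF that] unfolding C_def by linarith
  have "real (m 1) = real n - (\<Sum>s\<in>{2..K}. real (q s) * real (C s))"
    using le_n by (simp add: m_def of_nat_diff)
  also have "\<dots> = lam 1 * real n + (\<Sum>s\<in>{2..K}. lam s * real n - real (q s) * real (C s))"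
    using lam_n by (simp add: sum_subtractf)
  also have "\<dots> \<le> lam 1 * real n + (\<Sum>s\<in>{2..K}. real (C s))"
    using q(2) by (intro add_left_mono sum_mono) (auto simp: algebra_simps)
  finally have m1: "real (m 1) \<le> lam 1 * real n + (\<Sum>s\<in>{2..K}. real (C s))" .
  have "real message_size = (\<Sum>s\<in>{1..K}. real (m s) * real (C s) * ?\<rho> s)"
    unfolding message_size_def of_nat_sum of_nat_mult
    by (rule sum.cong) (simp_all only: C\<rho> mult.assoc)
  also have "\<dots> = real (m 1) * ?\<rho> 1 + (\<Sum>s\<in>{2..K}. real (q s) * real (C s) * ?\<rho> s)"
    unfolding split C1 by (simp add: m)
  also have "\<dots> \<le> (lam 1 * real n + (\<Sum>s\<in>{2..K}. real (C s))) * ?\<rho> 1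
      + (\<Sum>s\<in>{2..K}. lam s * real n * ?\<rho> s)"
    by (intro add_mono sum_mono mult_right_mono m1 q \<rho>) auto
  also have "\<dots> = ?y * real n + ?D"
    unfolding split by (simp add: algebra_simps sum_distrib_left)
  also have "\<dots> \<le> (?y + \<epsilon>) * real n" using n by (simp add: algebra_simps)
  finally have load: "real message_size / real n \<le> ?y + \<epsilon>"
    using n by (simp add: field_simps)
  show "\<exists>B>0. \<exists>E. uncoded_placement K ?S B E \<and>
      (\<forall>d. d permutes {1..K} \<longrightarrow>
        (\<exists>L X. is_delivery K B E d L X \<and> real L / real B \<le> ?y + \<epsilon>))"
  proof (intro exI conjI allI impI)
    show "uncoded_placement K ?S n placement"
      unfolding uncoded_placement_def using storage placement_subset size by blast
    show "is_delivery K n placement d message_size (codeword d)" if "d permutes {1..K}" for d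
      using is_delivery_codeword[OF that] by (simp add: size)
  qed (rule n(1), rule load)
qed

section \<open>Convex hull and infimum of loads\<close>

lemma achievable_convex_hull:
  assumes K: "K \<ge> 1"
    and hull: "(S, y) \<in> convex hull ((\<lambda>s. (real s, corner_load K s)) ` {1..K})"
  shows "achievable K S (\<lambda>d. y)"
proof -
  let ?f = "\<lambda>s. (real s, corner_load K s)"
  \<comment> \<open>Distinct first coordinates let weights on points be read as weights on
    \<open>s\<close>.\<close>
  have inj: "inj_on ?f {1..K}" by (auto simp: inj_on_def)
  obtain u where u: "\<forall>x\<in>?f ` {1..K}. 0 \<le> u x" "sum u (?f ` {1..K}) = 1"
      "(\<Sum>x\<in>?f ` {1..K}. u x *\<^sub>R x) = (S, y)"
    using hull by (auto simp: convex_hull_finite)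
  have "(S, y) = (\<Sum>s\<in>{1..K}. u (?f s) *\<^sub>R ?f s)"
    unfolding u(3)[symmetric] sum.reindex[OF inj] comp_def ..
  then have Sy: "S = (\<Sum>s\<in>{1..K}. u (?f s) * real s)"
    "y = (\<Sum>s\<in>{1..K}. u (?f s) * corner_load K s)"
    by (simp_all add: prod_eq_iff fst_sum snd_sum)
  have "(\<Sum>s\<in>{1..K}. u (?f s)) = 1"
    using u(2) unfolding sum.reindex[OF inj] comp_def .
  then show ?thesis
    unfolding Sy using u(1) by (intro achievable_memory_sharing[OF K]) auto
qed

text \<open>Half of \<epsilon> goes to a point of \<open>A\<close> near the infimum, half to its
  scheme; so the infimum need not be attained.\<close>

lemma achievable_Inf:
  assumes "A \<noteq> {}" "\<And>y. y \<in> A \<Longrightarrow> achievable K S (\<lambda>d. y)"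
  shows "achievable K S (\<lambda>d. Inf A)"
  unfolding achievable_def
proof (intro allI impI)
  fix \<epsilon> :: real assume "\<epsilon> > 0"
  then obtain y where y: "y \<in> A" "y < Inf A + \<epsilon> / 2"
    using cInf_lessD[of A "Inf A + \<epsilon> / 2"] assms(1) by auto
  then obtain B E where "B > 0" "uncoded_placement K S B E"
    "\<And>d. d permutes {1..K} \<Longrightarrow> \<exists>L X. is_delivery K B E d L X \<and> real L / real B \<le> y + \<epsilon> / 2"
    using assms(2)[OF y(1)] \<open>\<epsilon> > 0\<close> unfolding achievable_def by (meson half_gt_zero)
  moreover have "y + \<epsilon> / 2 \<le> Inf A + \<epsilon>" using y by simp
  ultimately show "\<exists>B>0. \<exists>E. uncoded_placement K S B E \<and> (\<forall>d. d permutes {1..K} \<longrightarrow>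
      (\<exists>L X. is_delivery K B E d L X \<and> real L / real B \<le> Inf A + \<epsilon>))"
    by (meson order_trans)
qed

text \<open>Bounds the set in \<open>optimal_load\<close> from below, so that its infimum is at most
  each member. The identity assignment supplies an actual load.\<close>

lemma achievable_nonneg:
  assumes "achievable K S (\<lambda>d. r)"
  shows "r \<ge> 0"
proof (rule field_le_epsilon)
  fix e :: real assume "e > 0"
  then obtain B L where "real L / real B \<le> r + e"
    using assms permutes_id unfolding achievable_def by metis
  then show "0 \<le> r + e" by (rule order_trans[rotated]) simp
qed

text \<open>The segment between the first and the last point passes over \<open>S\<close>.\<close>

lemma hull_section_nonempty:
  assumes "1 \<le> S" "S \<le> real K"
  shows "{y. (S, y) \<in> convex hull ((\<lambda>s. (real s, f s)) ` {1..K})} \<noteq> {}"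
proof -
  let ?P = "(\<lambda>s. (real s, f s)) ` {1..K}"
  \<comment> \<open>For \<open>K = 1\<close> division by zero gives \<open>t = 0\<close>, which fits
    because then \<open>S = 1\<close>.\<close>
  define t where "t = (S - 1) / (real K - 1)"
  have K: "K \<ge> 1" using assms by linarith
  have t: "0 \<le> t" "t \<le> 1" using assms by (auto simp: t_def divide_simps)
  have "(real 1, f 1) \<in> convex hull ?P" "(real K, f K) \<in> convex hull ?P"
    using K by (auto intro!: hull_inc)
  then have "(1 - t) *\<^sub>R (real 1, f 1) + t *\<^sub>R (real K, f K) \<in> convex hull ?P"
    using t by (intro convexD[OF convex_convex_hull]) auto
  moreover have "S = (1 - t) + t * real K"
  proof -
    have "t * (real K - 1) = S - 1" using assms by (cases "real K = 1") (auto simp: t_def)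
    then show ?thesis by (simp add: algebra_simps)
  qed
  ultimately show ?thesis by auto
qed

theorem theorem1:
  fixes K :: nat
  assumes "K \<ge> 1"
  shows "(\<forall>s\<in>{1..K}.
            achievable K (real s) (\<lambda>d. corner_load K s) \<and>
            optimal_load K (real s) \<le> corner_load K s) \<and>
         (\<forall>S::real. 1 \<le> S \<and> S \<le> real K \<and> S \<notin> \<int> \<longrightarrow>
            achievable K S
              (\<lambda>d. lower_convex_envelope ((\<lambda>s. (real s, corner_load K s)) ` {1..K}) S))"
proof (intro conjI ballI allI impI)
  fix s assume "s \<in> {1..K}"
  then show ach: "achievable K (real s) (\<lambda>d. corner_load K s)"
    by (intro achievable_convex_hull[OF assms] hull_inc) auto
  show "optimal_load K (real s) \<le> corner_load K s"
    unfolding optimal_load_def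
    by (rule cInf_lower) (auto intro: ach bdd_belowI[of _ 0] achievable_nonneg)
next
  fix S :: real assume "1 \<le> S \<and> S \<le> real K \<and> S \<notin> \<int>"
  then show "achievable K S
      (\<lambda>d. lower_convex_envelope ((\<lambda>s. (real s, corner_load K s)) ` {1..K}) S)"
    unfolding lower_convex_envelope_def
    using achievable_convex_hull[OF assms]
    by (intro achievable_Inf hull_section_nonempty) auto
qed

end
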